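(* For every integer $n \geq 0$ and every integer $\ell \geq 1$, both $P^\ell_n$ and $C^\ell_n$ have unimodal domination sequences; that is, for $G \in \{P^\ell_n, C^\ell_n\}$ the sequence $(\gamma_k(G))_{k\geq 0}$ is unimodal.
   Context: A dominating set in a graph $G$ is a set $D$ of vertices such that every vertex of $G$ is in $D$ or adjacent to a vertex of $D$. $\gamma_k(G)$ denotes the number of dominating sets of $G$ of size $k$; the sequence $(\gamma_k(G))_{k \geq 0}$ is the domination sequence of $G$. A sequence $(a_k)_{k\geq 0}$ is unimodal if there is an index $m$ with $a_0 \leq a_1 \leq \cdots \leq a_m \geq a_{m+1} \geq a_{m+2} \geq \cdots$. For a graph $G$ and positive integer $\ell$, the $\ell$th power of $G$ is the graph on the same vertex set in which two distinct vertices are adjacent iff their distance in $G$ is at most $\ell$. $P^\ell_n$ is the $\ell$th power of the path on $n$ vertices and $C^\ell_n$ is the $\ell$th power of the cycle on $n$ vertices. By convention $P^\ell_0$ and $C^\ell_0$ are the graph with no vertices (which has exactly one dominating set, the empty set), $C^\ell_1$ is a single isolated vertex, and $C^\ell_2$ is the complete graph on two vertices. *)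

theory Defs
  imports Main "HOL-Library.Extended_Nat"
begin

record 'a graph =
  verts :: "'a set"
  edges :: "'a set set"

definition simple_graph :: "'a graph \<Rightarrow> bool" where
  "simple_graph G \<longleftrightarrow> finite (verts G) \<and> (\<forall>e\<in>edges G. e \<subseteq> verts G \<and> card e = 2)"

definition adjacent :: "'a graph \<Rightarrow> 'a \<Rightarrow> 'a \<Rightarrow> bool" where
  "adjacent G u v \<longleftrightarrow> {u, v} \<in> edges G"

definition walk :: "'a graph \<Rightarrow> 'a \<Rightarrow> 'a list \<Rightarrow> 'a \<Rightarrow> bool" where
  "walk G u p v \<longleftrightarrow> p \<noteq> [] \<and> hd p = u \<and> last p = v \<and> set p \<subseteq> verts G \<and> successively (adjacent G) p"

(* A walk is given by its vertices, so it has one edge fewer than the list has entries.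
   The infimum of the empty set is \<infinity>: vertices in different components are at distance \<infinity>. *)
definition gdist :: "'a graph \<Rightarrow> 'a \<Rightarrow> 'a \<Rightarrow> enat" where
  "gdist G u v = (INF p\<in>{p. walk G u p v}. enat (length p - 1))"

definition graph_power :: "nat \<Rightarrow> 'a graph \<Rightarrow> 'a graph" where
  "graph_power l G = \<lparr>verts = verts G,
     edges = {{u, v} |u v. u \<in> verts G \<and> v \<in> verts G \<and> u \<noteq> v \<and> gdist G u v \<le> enat l}\<rparr>"

definition path_graph :: "nat \<Rightarrow> nat graph" where
  "path_graph n = \<lparr>verts = {..<n}, edges = {{i, Suc i} |i. Suc i < n}\<rparr>"

(* The condition Suc i mod n \<noteq> i only matters for n = 1, where it excludes the loop. *)
definition cycle_graph :: "nat \<Rightarrow> nat graph" where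
  "cycle_graph n = \<lparr>verts = {..<n}, edges = {{i, Suc i mod n} |i. i < n \<and> Suc i mod n \<noteq> i}\<rparr>"

definition dominating_set :: "'a graph \<Rightarrow> 'a set \<Rightarrow> bool" where
  "dominating_set G D \<longleftrightarrow> D \<subseteq> verts G \<and> (\<forall>v\<in>verts G. v \<in> D \<or> (\<exists>u\<in>D. adjacent G v u))"

definition domination_seq :: "'a graph \<Rightarrow> nat \<Rightarrow> nat" where
  "domination_seq G k = card {D. dominating_set G D \<and> card D = k}"

definition unimodal :: "(nat \<Rightarrow> 'a::linorder) \<Rightarrow> bool" where
  "unimodal a \<longleftrightarrow> (\<exists>m. (\<forall>k<m. a k \<le> a (Suc k)) \<and> (\<forall>k\<ge>m. a (Suc k) \<le> a k))"

lemma simple_graph_path_graph: "simple_graph (path_graph n)"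
  by (auto simp: simple_graph_def path_graph_def)

lemma simple_graph_cycle_graph: "simple_graph (cycle_graph n)"
  by (auto simp: simple_graph_def cycle_graph_def card_2_iff)

lemma simple_graph_graph_power: "simple_graph G \<Longrightarrow> simple_graph (graph_power l G)"
  by (auto simp: simple_graph_def graph_power_def)

lemma cycle_graph_0: "cycle_graph 0 = \<lparr>verts = {}, edges = {}\<rparr>"
  by (simp add: cycle_graph_def)

lemma cycle_graph_1: "cycle_graph 1 = \<lparr>verts = {0}, edges = {}\<rparr>"
  by (auto simp: cycle_graph_def)

lemma cycle_graph_2: "cycle_graph 2 = \<lparr>verts = {0, 1}, edges = {{0, 1}}\<rparr>"
proof -
  have "{{i, Suc i mod 2} |i. i < 2 \<and> Suc i mod 2 \<noteq> i} = (\<lambda>i. {i, Suc i mod 2}) ` {i\<in>{0::nat, 1}. Suc i mod 2 \<noteq> i}"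
    by (auto simp: less_2_cases_iff)
  also have "{i\<in>{0::nat, 1}. Suc i mod 2 \<noteq> i} = {0, 1}"
    by auto
  also have "(\<lambda>i. {i, Suc i mod 2}) ` {0::nat, 1} = {{0, 1}}"
    by (simp add: insert_commute)
  finally show ?thesis
    by (simp add: cycle_graph_def lessThan_Suc numeral_2_eq_2 insert_commute)
qed

end

theory Submission
  imports Defs "HOL-Number_Theory.Cong"
begin

text \<open>Domination sequences are upward closed, so it suffices to show that they are log-concave. A
  dominating set is a set of integers that meets every interval of a suitable family. Given such
  sets \<open>A\<close> and \<open>B\<close> with \<open>k\<close> and \<open>k + 2\<close> elements, cut both at a position \<open>t\<close> below which \<open>B\<close> has
  exactly one element more than \<open>A\<close> and exchange the parts above \<open>t\<close>; this yields two sets of size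
  \<open>k + 1\<close>. The position where the surplus of \<open>B\<close> is about to reach \<open>2\<close> is always an admissible cut,
  and cutting at the least admissible one makes the exchange an involution.

  For the cycle, rotate a dominating set so that its largest element becomes \<open>n\<close> and remember the
  rotation as a mark below the least element. Exchanges whose cut lies above both minima
  preserve the marks. Pairs without such a cut have the two least elements of \<open>B\<close> below \<open>Min A\<close>
  and are handled by an explicit injection that moves one element and possibly the mark.\<close>

section \<open>Log-concavity and unimodality\<close>

text \<open>After the first strict descent, log-concavity passes the descent on as long as the terms
  are positive. \<open>pos\<close> excludes internal zeros, as in 1, 0, 0, 1, which log-concavity
  alone permits.\<close>

lemma unimodal_if_log_concave:
  fixes a :: "nat \<Rightarrow> nat"
  assumes log_concave: "\<And>k. a k * a (k + 2) \<le> a (k + 1) * a (k + 1)"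
    and pos: "\<And>i j. a i > 0 \<Longrightarrow> i \<le> j \<Longrightarrow> j \<le> n \<Longrightarrow> a j > 0"
    and zero: "\<And>k. k > n \<Longrightarrow> a k = 0"
  shows "unimodal a"
proof (cases "\<exists>m. a (Suc m) < a m")
  case True
  define m where "m = (LEAST m. a (Suc m) < a m)"
  have m: "a (Suc m) < a m"
    unfolding m_def using True by (rule LeastI_ex)
  have less: "a k \<le> a (Suc k)" if "k < m" for k
    using not_less_Least[OF that[unfolded m_def]] by simp
  have "a (Suc k) \<le> a k" if "k \<ge> m" for k
    using that
  proof (induction k rule: dec_induct)
    case base
    then show ?case using m by simp
  next
    case (step k)
    show ?case
    proof (cases "a (Suc k) = 0")
      case True
      have "Suc k > n"
      proof (rule ccontr)
        assume "\<not> Suc k > n"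
        then have "a (Suc k) > 0"
          using pos[of m "Suc k"] m step by simp
        with True show False by simp
      qed
      then show ?thesis using zero[of "Suc (Suc k)"] by simp
    next
      case False
      have "a k * a (Suc (Suc k)) \<le> a (Suc k) * a (Suc k)"
        using log_concave[of k] by simp
      also have "\<dots> \<le> a k * a (Suc k)"
        using step by simp
      finally show ?thesis
        using False step by simp
    qed
  qed
  with less show ?thesis unfolding unimodal_def by blast
next
  case False
  then have "a k \<le> a (Suc k)" for k
    by (simp add: not_less)
  then show ?thesis
    unfolding unimodal_def using zero by (intro exI[of _ n]) auto
qed

section \<open>Hitting sets of a family of intervals\<close>

definition glue :: "nat \<Rightarrow> nat set \<Rightarrow> nat set \<Rightarrow> nat set" where
  "glue t A B = A \<inter> {..<t} \<union> B \<inter> {t..}"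

lemma glue_Int_lessThan: "s \<le> t \<Longrightarrow> glue t A B \<inter> {..<s} = A \<inter> {..<s}"
  by (auto simp: glue_def)

lemma glue_glue [simp]: "glue t (glue t A B) (glue t B A) = A"
  by (auto simp: glue_def)

lemma card_split_at:
  fixes A :: "nat set"
  assumes "finite A"
  shows "card A = card (A \<inter> {..<t}) + card (A \<inter> {t..})"
proof -
  have "A = A \<inter> {..<t} \<union> A \<inter> {t..}" by auto
  then show ?thesis
    using assms by (metis (no_types, lifting) card_Un_disjoint disjoint_iff finite_Int Int_iff
        atLeast_iff lessThan_iff not_less)
qed

lemma card_glue:
  assumes "finite A" "finite B"
  shows "card (glue t A B) = card (A \<inter> {..<t}) + card (B \<inter> {t..})"
  unfolding glue_def using assms by (intro card_Un_disjoint) auto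

text \<open>Marks lie below the minimum, so they survive an exchange whose cut has an element of
  \<open>A\<close> below it.\<close>

lemma Min_glue:
  assumes "finite A" "finite B" "A \<inter> {..<t} \<noteq> {}"
  shows "Min (glue t A B) = Min A"
proof -
  obtain a where a: "a \<in> A" "a < t" using assms by auto
  have "Min A \<in> A" using assms(1) a(1) by (intro Min_in) auto
  moreover have "Min A < t" using Min_le[OF assms(1) a(1)] a(2) by simp
  ultimately show ?thesis
    using assms Min_le[of A]
    by (intro Min_eqI) (auto simp: glue_def)
qed

locale interval_family =
  fixes \<W> :: "nat set set"
  assumes convex: "\<lbrakk>W \<in> \<W>; x \<in> W; z \<in> W; x \<le> y; y \<le> z\<rbrakk> \<Longrightarrow> y \<in> W"
begin

definition hits :: "nat set \<Rightarrow> bool" where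
  "hits D \<longleftrightarrow> (\<forall>W\<in>\<W>. D \<inter> W \<noteq> {})"

text \<open>An admissible cut. The surplus of one turns the sizes \<open>k\<close> and
  \<open>k + 2\<close> both into \<open>k + 1\<close>. The path uses \<open>c = 0\<close>; the cycle
  uses \<open>c = 1\<close>, which keeps both lower parts nonempty and hence both minima.\<close>

definition crossing :: "nat \<Rightarrow> nat set \<Rightarrow> nat set \<Rightarrow> nat \<Rightarrow> bool" where
  "crossing c A B t \<longleftrightarrow> c \<le> card (A \<inter> {..<t}) \<and> card (B \<inter> {..<t}) = Suc (card (A \<inter> {..<t})) \<and>
     hits (glue t A B) \<and> hits (glue t B A)"

lemma hits_mono: "hits A \<Longrightarrow> A \<subseteq> B \<Longrightarrow> hits B"
  unfolding hits_def by blast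

lemma crossing_glue:
  assumes "hits A" "hits B" "crossing c A B t"
  shows "crossing c (glue t A B) (glue t B A) t"
  using assms by (simp add: crossing_def glue_Int_lessThan)

text \<open>The twice glued set is \<open>A\<close> below \<open>s\<close>, \<open>B\<close> on
  \<open>{s..<t}\<close> and \<open>A\<close> from \<open>t\<close> on. A window that meets it only
  from \<open>t\<close> on and meets \<open>B\<close> only below \<open>s\<close> covers
  \<open>{s..<t}\<close>, where \<open>B\<close> has an element.\<close>

lemma hits_splice_earlier:
  assumes hits: "hits (glue s (glue t A B) (glue t B A))" "hits B"
    and "s < t" "B \<inter> {s..<t} \<noteq> {}"
  shows "hits (glue s A B)"
  unfolding hits_def
proof (intro ballI)
  fix W assume W: "W \<in> \<W>"
  obtain x where x: "x \<in> W" "x \<in> glue s (glue t A B) (glue t B A)"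
    using hits(1) W unfolding hits_def by blast
  obtain y where y: "y \<in> W" "y \<in> B"
    using hits(2) W unfolding hits_def by blast
  obtain z where z: "z \<in> B" "s \<le> z" "z < t"
    using assms(4) by auto
  consider "x < t" | "y \<ge> s" | "y < s" "x \<ge> t" by linarith
  then show "glue s A B \<inter> W \<noteq> {}"
  proof cases
    case 1
    then show ?thesis using x \<open>s < t\<close> by (auto simp: glue_def)
  next
    case 2
    then show ?thesis using y by (auto simp: glue_def)
  next
    case 3
    then have "z \<in> W" using convex[OF W y(1) x(1), of z] z by simp
    then show ?thesis using z by (auto simp: glue_def)
  qed
qed

text \<open>An exchange at \<open>t\<close> creates no new cut before \<open>t\<close>, so the least
  cut cannot move down.\<close>

lemma crossing_earlier:
  assumes fin: "finite A" "finite B" and hits: "hits A" "hits B"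
    and t: "crossing c A B t" and s: "crossing c (glue t A B) (glue t B A) s" and "s < t"
  shows "crossing c A B s"
proof -
  have low: "c \<le> card (A \<inter> {..<s})" "card (B \<inter> {..<s}) = Suc (card (A \<inter> {..<s}))"
    using s \<open>s < t\<close> by (auto simp: crossing_def glue_Int_lessThan)
  have split: "card (X \<inter> {..<t}) = card (X \<inter> {..<s}) + card (X \<inter> {s..<t})"
    if "finite X" for X :: "nat set"
  proof -
    have "X \<inter> {..<t} \<inter> {..<s} = X \<inter> {..<s}" "X \<inter> {..<t} \<inter> {s..} = X \<inter> {s..<t}"
      using \<open>s < t\<close> by auto
    then show ?thesis using card_split_at[of "X \<inter> {..<t}" s] that by simp
  qed
  \<comment> \<open>The surplus of \<open>B\<close> is one at \<open>s\<close> and at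
    \<open>t\<close>. If nothing lies in between, both cuts give the same sets; otherwise both sets
    have elements there.\<close>
  have "card (A \<inter> {s..<t}) = card (B \<inter> {s..<t})"
    using low t split[OF fin(1)] split[OF fin(2)] by (simp add: crossing_def)
  then consider "A \<inter> {s..<t} = {}" "B \<inter> {s..<t} = {}" | "A \<inter> {s..<t} \<noteq> {}" "B \<inter> {s..<t} \<noteq> {}"
    using fin by (metis card_0_eq finite_Int)
  then have "hits (glue s A B) \<and> hits (glue s B A)"
  proof cases
    case 1
    have same: "glue s X Y = glue t X Y"
      if "X \<inter> {s..<t} = {}" "Y \<inter> {s..<t} = {}" for X Y
    proof -
      have "x < s \<or> x \<ge> t" if "x \<in> X \<union> Y" for x
        using that \<open>X \<inter> {s..<t} = {}\<close> \<open>Y \<inter> {s..<t} = {}\<close> by fastforce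
      then show ?thesis
        using \<open>s < t\<close> unfolding glue_def by fastforce
    qed
    show ?thesis using same 1 t by (simp add: crossing_def)
  next
    case 2
    then show ?thesis
      using hits_splice_earlier[of s t A B] hits_splice_earlier[of s t B A] hits s \<open>s < t\<close>
      by (simp add: crossing_def)
  qed
  with low show ?thesis by (simp add: crossing_def)
qed

section \<open>Exchange at the least admissible cut\<close>

definition first_crossing :: "nat \<Rightarrow> nat set \<times> nat set \<Rightarrow> nat" where
  "first_crossing c = (\<lambda>(A, B). LEAST t. crossing c A B t)"

definition swap :: "nat \<Rightarrow> nat set \<times> nat set \<Rightarrow> nat set \<times> nat set" where
  "swap c P = (case P of (A, B) \<Rightarrow>
     (glue (first_crossing c P) A B, glue (first_crossing c P) B A))"

lemma crossing_first:
  assumes "\<exists>t. crossing c A B t"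
  shows "crossing c A B (first_crossing c (A, B))"
  unfolding first_crossing_def using assms by (auto intro: LeastI)

text \<open>The old cut remains admissible, and an earlier cut of the new pair would have been one
  of the old pair. This makes \<open>swap\<close> an involution.\<close>

lemma first_crossing_swap:
  assumes "finite A" "finite B" "hits A" "hits B" "\<exists>t. crossing c A B t"
  shows "first_crossing c (swap c (A, B)) = first_crossing c (A, B)"
proof -
  let ?t = "first_crossing c (A, B)"
  have t: "crossing c A B ?t" using crossing_first[OF assms(5)] .
  have "?t \<le> s" if "crossing c (glue ?t A B) (glue ?t B A) s" for s
  proof (rule ccontr)
    assume "\<not> ?t \<le> s"
    then have "s < ?t" by simp
    from crossing_earlier[OF assms(1-4) t that this] show False
      using \<open>s < ?t\<close> not_less_Least unfolding first_crossing_def by auto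
  qed
  then show ?thesis
    using crossing_glue[OF assms(3,4) t] unfolding swap_def first_crossing_def
    by (auto intro!: Least_equality)
qed

lemma swap_swap:
  assumes "finite A" "finite B" "hits A" "hits B" "\<exists>t. crossing c A B t"
  shows "swap c (swap c (A, B)) = (A, B)"
  using first_crossing_swap[OF assms] by (simp add: swap_def)

text \<open>The cut is at the element \<open>u\<close> with which the surplus of \<open>B\<close>
  first reaches 2. Its membership in \<open>B\<close> but not in \<open>A\<close> is recorded to
  locate the minima when no cut with \<open>c = 1\<close> exists.\<close>

lemma crossing_exists:
  assumes fin: "finite A" "finite B" and hits: "hits A" "hits B"
    and card: "card A + 2 \<le> card B"
  obtains u where "u \<in> B" "u \<notin> A" "crossing 0 A B u"
proof -
  let ?P = "\<lambda>N. card (A \<inter> {..<N}) + 2 \<le> card (B \<inter> {..<N})"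
  have "finite (A \<union> B)" using fin by simp
  then obtain N where "A \<union> B \<subseteq> {..<N}"
    by (metis finite_nat_iff_bounded)
  then have "A \<inter> {..<N} = A" "B \<inter> {..<N} = B" by auto
  then have ex: "?P N" using card by simp
  define N0 where "N0 = (LEAST N. ?P N)"
  have N0: "?P N0" unfolding N0_def using ex by (rule LeastI)
  have below: "card (B \<inter> {..<x}) \<le> card (A \<inter> {..<x}) + 1" if "x < N0" for x
    using not_less_Least[OF that[unfolded N0_def]] by simp
  have "N0 \<noteq> 0" using N0 by (cases "N0 = 0") auto
  then obtain u where u: "N0 = Suc u" by (cases N0) auto
  have step: "card (X \<inter> {..<Suc u}) = card (X \<inter> {..<u}) + (if u \<in> X then 1 else 0)"
    if "finite X" for X
    using that by (simp add: lessThan_Suc Int_insert_right)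
  have mem: "u \<in> B" "u \<notin> A" "card (B \<inter> {..<u}) = Suc (card (A \<inter> {..<u}))"
    using N0 below[of u] step[OF fin(1)] step[OF fin(2)] u by (auto split: if_splits)
  \<comment> \<open>A missed window would meet \<open>B\<close> only below \<open>u\<close> and
    \<open>A\<close> only from \<open>u\<close> on. So it would contain \<open>u\<close>, which lies
    in the upper part of \<open>B\<close>.\<close>
  have "hits (glue u A B)"
    unfolding hits_def
  proof (intro ballI notI)
    fix W assume W: "W \<in> \<W>" and empty: "glue u A B \<inter> W = {}"
    obtain a b where ab: "a \<in> A" "a \<in> W" "b \<in> B" "b \<in> W"
      using hits W unfolding hits_def by blast
    then have "b \<le> u" "u \<le> a"
      using empty unfolding glue_def by (auto simp: disjoint_iff not_le)
    then have "u \<in> W" using convex[OF W ab(4,2)] by simp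
    then show False using mem empty by (auto simp: glue_def)
  qed
  \<comment> \<open>In a missed window with \<open>a < u \<le> b\<close>, the set \<open>B\<close>
    has no element in \<open>{a..<u}\<close>, while \<open>A\<close> has \<open>a\<close>. The
    surplus would thus be 2 already at \<open>a\<close>, against the choice of
    \<open>N0\<close>.\<close>
  moreover have "hits (glue u B A)"
    unfolding hits_def
  proof (intro ballI notI)
    fix W assume W: "W \<in> \<W>" and empty: "glue u B A \<inter> W = {}"
    obtain a b where ab: "a \<in> A" "a \<in> W" "b \<in> B" "b \<in> W"
      using hits W unfolding hits_def by blast
    then have "a < u" "u \<le> b"
      using empty unfolding glue_def by (auto simp: disjoint_iff not_le)
    have "y < a" if "y \<in> B" "y < u" for y
    proof (rule ccontr)
      assume "\<not> y < a"
      then have "y \<in> W" using convex[OF W ab(2,4), of y] that \<open>u \<le> b\<close> by simp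
      then show False using that empty by (auto simp: glue_def)
    qed
    then have "B \<inter> {..<u} = B \<inter> {..<a}" using \<open>a < u\<close> by auto
    moreover have "Suc (card (A \<inter> {..<a})) \<le> card (A \<inter> {..<u})"
    proof -
      have "card (insert a (A \<inter> {..<a})) \<le> card (A \<inter> {..<u})"
        using fin ab \<open>a < u\<close> by (intro card_mono) auto
      then show ?thesis using fin by simp
    qed
    ultimately show False using mem(3) below[of a] \<open>a < u\<close> u by simp
  qed
  ultimately have "crossing 0 A B u" using mem by (simp add: crossing_def)
  with mem show thesis by (intro that)
qed

definition hitting :: "nat set \<Rightarrow> nat \<Rightarrow> nat set set" where
  "hitting U k = {D. D \<subseteq> U \<and> hits D \<and> card D = k}"

lemma finite_hitting: "finite U \<Longrightarrow> finite (hitting U k)"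
  by (rule finite_subset[of _ "Pow U"]) (auto simp: hitting_def)

lemma swap_hitting:
  assumes U: "finite U" and A: "A \<in> hitting U k" and B: "B \<in> hitting U (k + 2)"
    and ex: "\<exists>t. crossing c A B t"
  shows "swap c (A, B) \<in> hitting U (k + 1) \<times> hitting U (k + 1)"
proof -
  define t where "t = first_crossing c (A, B)"
  have t: "crossing c A B t" unfolding t_def using crossing_first[OF ex] .
  have fin: "finite A" "finite B"
    using A B U by (auto simp: hitting_def intro: finite_subset)
  have "glue t A B \<subseteq> U" "glue t B A \<subseteq> U"
    using A B by (auto simp: hitting_def glue_def)
  moreover have "card (glue t A B) = k + 1" "card (glue t B A) = k + 1"
    using A B t card_split_at[OF fin(1), of t] card_split_at[OF fin(2), of t]
    by (auto simp: card_glue fin hitting_def crossing_def)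
  ultimately show ?thesis
    using t unfolding swap_def t_def by (simp add: hitting_def crossing_def)
qed

text \<open>With \<open>c = 0\<close> every pair has a cut, so the involution \<open>swap 0\<close>
  is injective on all pairs.\<close>

lemma card_hitting_log_concave:
  assumes "finite U"
  shows "card (hitting U k) * card (hitting U (k + 2)) \<le> card (hitting U (k + 1)) * card (hitting U (k + 1))"
proof -
  let ?X = "hitting U k \<times> hitting U (k + 2)"
  have D: "finite A" "hits A" "card A = j" if "A \<in> hitting U j" for A j
    using that assms by (auto simp: hitting_def intro: finite_subset)
  have ex: "\<exists>t. crossing 0 A B t" if "A \<in> hitting U k" "B \<in> hitting U (k + 2)" for A B
    using crossing_exists[of A B] D[OF that(1)] D[OF that(2)] by auto
  have "inj_on (swap 0) ?X"
  proof (rule inj_on_inverseI)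
    fix P assume "P \<in> ?X"
    then obtain A B where P: "P = (A, B)" "A \<in> hitting U k" "B \<in> hitting U (k + 2)" by auto
    then show "swap 0 (swap 0 P) = P"
      using swap_swap[of A B 0] D[OF P(2)] D[OF P(3)] ex[OF P(2,3)] by simp
  qed
  moreover have "swap 0 ` ?X \<subseteq> hitting U (k + 1) \<times> hitting U (k + 1)"
  proof (rule image_subsetI)
    fix P assume "P \<in> ?X"
    then obtain A B where P: "P = (A, B)" "A \<in> hitting U k" "B \<in> hitting U (k + 2)" by auto
    then show "swap 0 P \<in> hitting U (k + 1) \<times> hitting U (k + 1)"
      using swap_hitting[OF assms P(2,3) ex[OF P(2,3)]] by simp
  qed
  ultimately have "card ?X \<le> card (hitting U (k + 1) \<times> hitting U (k + 1))"
    using assms by (intro card_inj_on_le[of "swap 0"]) (auto simp: finite_hitting)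
  then show ?thesis by (simp add: card_cartesian_product)
qed

section \<open>Marked hitting sets\<close>

definition marked_hitting :: "nat \<Rightarrow> nat \<Rightarrow> (nat \<times> nat set) set" where
  "marked_hitting n k = (SIGMA D:hitting {..n} k. {..<Min D})\<inverse>"

lemma mem_marked_hitting:
  "(i, D) \<in> marked_hitting n k \<longleftrightarrow> D \<in> hitting {..n} k \<and> i < Min D"
  by (simp add: marked_hitting_def)

lemma finite_marked_hitting: "finite (marked_hitting n k)"
  unfolding marked_hitting_def by (auto intro!: finite_SigmaI finite_hitting)

definition marked_swap ::
  "(nat \<times> nat set) \<times> (nat \<times> nat set) \<Rightarrow> (nat \<times> nat set) \<times> (nat \<times> nat set)" where
  "marked_swap = (\<lambda>((i, A), (j, B)). ((i, fst (swap 1 (A, B))), (j, snd (swap 1 (A, B)))))"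

text \<open>With \<open>j < b < x\<close> and \<open>i < Min A\<close>, where \<open>b < x\<close> are the two least elements of \<open>B\<close> and
  \<open>x < Min A\<close>, the set \<open>A\<close> receives \<open>b\<close> if \<open>i < x\<close> and \<open>i\<close> otherwise. The new minimum is
  below \<open>x\<close> in the first case only, so the cases can be told apart.\<close>

definition move ::
  "(nat \<times> nat set) \<times> (nat \<times> nat set) \<Rightarrow> (nat \<times> nat set) \<times> (nat \<times> nat set)" where
  "move = (\<lambda>((i, A), (j, B)). let b = Min B; C = B - {b} in
     if i < Min C then ((i, C), (j, insert b A)) else ((b, C), (j, insert i A)))"

text \<open>Inverse of \<open>move\<close> on its image: \<open>Min D\<close> is the inserted
  element, and the test against \<open>Min C\<close> tells whether it was the least element of
  \<open>B\<close> or the mark of \<open>A\<close>.\<close>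

definition unmove ::
  "(nat \<times> nat set) \<times> (nat \<times> nat set) \<Rightarrow> (nat \<times> nat set) \<times> (nat \<times> nat set)" where
  "unmove = (\<lambda>((i, C), (j, D)). let y = Min D; A = D - {y} in
     if y < Min C then ((i, A), (j, insert y C)) else ((y, A), (j, insert i C)))"

text \<open>The cut \<open>u\<close> that always exists violates only the bound for
  \<open>c = 1\<close>, so no element of \<open>A\<close> and just one of \<open>B\<close> lies
  below it. Hence \<open>u\<close> is the second element of \<open>B\<close>, and it is below
  \<open>Min A\<close> because it is not in \<open>A\<close>.\<close>

lemma no_crossing_low:
  assumes fin: "finite A" "finite B" and hits: "hits A" "hits B"
    and card: "card A + 2 \<le> card B" and "A \<noteq> {}"
    and no: "\<nexists>t. crossing 1 A B t"
  shows "Min (B - {Min B}) < Min A" "Min B < Min (B - {Min B})"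
proof -
  obtain u where u: "u \<in> B" "u \<notin> A" "crossing 0 A B u"
    using crossing_exists[OF fin hits card] .
  then have "\<not> 1 \<le> card (A \<inter> {..<u})" "card (B \<inter> {..<u}) = Suc (card (A \<inter> {..<u}))"
    using no unfolding crossing_def by auto
  then have "card (A \<inter> {..<u}) = 0" "card (B \<inter> {..<u}) = 1" by linarith+
  then have A: "A \<inter> {..<u} = {}" and "\<exists>b. B \<inter> {..<u} = {b}"
    using fin unfolding One_nat_def card_1_singleton_iff by simp_all
  then obtain b where b: "B \<inter> {..<u} = {b}" by blast
  have only_b: "x = b \<or> u \<le> x" if "x \<in> B" for x
    using b that by (metis IntI lessThan_iff not_less singletonD)
  have "b \<in> B \<inter> {..<u}" unfolding b by simp
  then have "b \<in> B" "b < u" by simp_all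
  have "b \<le> x" if "x \<in> B" for x
    using only_b[OF that] \<open>b < u\<close> by linarith
  then have minB: "Min B = b"
    using \<open>b \<in> B\<close> fin by (intro Min_eqI)
  have "u \<le> x" if "x \<in> B - {b}" for x
    using only_b[of x] that by simp
  then have minC: "Min (B - {b}) = u"
    using \<open>b < u\<close> u fin by (intro Min_eqI) auto
  have "Min A \<in> A" using fin \<open>A \<noteq> {}\<close> by (intro Min_in)
  then have "u < Min A" using A u(2) by (metis Int_iff empty_iff lessThan_iff linorder_neqE_nat)
  then show "Min (B - {Min B}) < Min A" "Min B < Min (B - {Min B})"
    using minB minC \<open>b < u\<close> by auto
qed

text \<open>Keeps the images of \<open>move\<close> and of the exchange disjoint: a cut after the
  move would have been a cut before it.\<close>

lemma no_crossing_move: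
  assumes fin: "finite A" "finite B" and hits: "hits A" "hits B" and "A \<noteq> {}" "B - {Min B} \<noteq> {}"
    and x: "Min (B - {Min B}) < Min A" "Min B < Min (B - {Min B})" and y: "y < Min A"
    and t: "crossing 1 (B - {Min B}) (insert y A) t"
  shows "crossing 1 A B t"
proof -
  let ?b = "Min B" and ?C = "B - {Min B}"
  have "B \<noteq> {}" using assms(6) by auto
  then have b: "?b \<in> B" using fin by simp
  have "y \<notin> A" using y fin by (meson Min_le not_less)
  have "?C \<inter> {..<t} \<noteq> {}" using t by (auto simp: crossing_def)
  then obtain c where "c \<in> ?C" "c < t" by auto
  then have "Min ?C < t" using fin Min_le[of ?C c] by (meson finite_Diff le_less_trans)
  then have "?b < t" using x(2) by simp
  then have "B \<inter> {..<t} = insert ?b (?C \<inter> {..<t})" using b by auto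
  then have B: "card (B \<inter> {..<t}) = Suc (card (?C \<inter> {..<t}))" using fin by simp
  \<comment> \<open>Below \<open>t\<close>, \<open>insert y A\<close> has one element more than the
    nonempty part of \<open>?C\<close>, so at least two, one of them from \<open>A\<close>.\<close>
  have "\<not> insert y A \<inter> {..<t} \<subseteq> {y}"
  proof
    assume "insert y A \<inter> {..<t} \<subseteq> {y}"
    then have "card (insert y A \<inter> {..<t}) \<le> card {y}" by (intro card_mono) auto
    then show False using t by (simp add: crossing_def)
  qed
  then obtain a where a: "a \<in> A" "a < t" by auto
  then have "Min A < t" using fin Min_le[of A a] by linarith
  then have "y < t" using y by simp
  then have "insert y A \<inter> {..<t} = insert y (A \<inter> {..<t})" by auto
  then have A: "card (insert y A \<inter> {..<t}) = Suc (card (A \<inter> {..<t}))"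
    using fin \<open>y \<notin> A\<close> by simp
  have "hits (glue t A B)"
    unfolding hits_def
  proof (intro ballI)
    fix W assume W: "W \<in> \<W>"
    obtain z where z: "z \<in> W" "z \<in> glue t (insert y A) ?C"
      using t W unfolding crossing_def hits_def by blast
    show "glue t A B \<inter> W \<noteq> {}"
    proof (cases "z = y")
      case True
      \<comment> \<open>A window hit in \<open>y\<close> also contains an element of
        \<open>A\<close>, hence by convexity \<open>Min A\<close>, which lies below the cut and
        replaces \<open>y\<close>.\<close>
      obtain a' where a': "a' \<in> A" "a' \<in> W" using hits W unfolding hits_def by blast
      have "Min A \<in> W"
        using convex[OF W z(1) a'(2), of "Min A"] a'(1) y True fin by simp
      moreover have "Min A \<in> A" "Min A < t"
        using fin(1) \<open>A \<noteq> {}\<close> \<open>Min A < t\<close> by simp_all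
      ultimately show ?thesis by (auto simp: glue_def)
    next
      case False
      then show ?thesis using z by (auto simp: glue_def)
    qed
  qed
  moreover have "hits (glue t B A)"
  proof (rule hits_mono)
    show "hits (glue t ?C (insert y A))" using t by (simp add: crossing_def)
    show "glue t ?C (insert y A) \<subseteq> glue t B A" using \<open>y < t\<close> by (auto simp: glue_def)
  qed
  ultimately show ?thesis using A B t by (simp add: crossing_def)
qed

text \<open>A window containing \<open>Min B\<close> reaches up to an element of \<open>A\<close>
  and so passes through the second element of \<open>B\<close>.\<close>

lemma hits_remove_Min:
  assumes fin: "finite A" "finite B" and hits: "hits A" "hits B" and "B - {Min B} \<noteq> {}"
    and x: "Min (B - {Min B}) < Min A" "Min B < Min (B - {Min B})"
  shows "hits (B - {Min B})"
  unfolding hits_def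
proof (intro ballI)
  fix W assume W: "W \<in> \<W>"
  obtain a b where ab: "a \<in> A" "a \<in> W" "b \<in> B" "b \<in> W"
    using hits W unfolding hits_def by blast
  let ?x = "Min (B - {Min B})"
  have "?x \<in> B - {Min B}" using fin assms(5) by (intro Min_in) auto
  moreover have "?x \<in> W" if "b = Min B"
    using convex[OF W ab(4,2), of ?x] x that fin Min_le[OF fin(1) ab(1)] by simp
  ultimately show "(B - {Min B}) \<inter> W \<noteq> {}"
    using ab by (cases "b = Min B") auto
qed

lemma Min_insert_less:
  fixes A :: "nat set"
  assumes "finite A" "y < Min A"
  shows "Min (insert y A) = y \<and> y \<notin> A"
proof -
  have "y < x" if "x \<in> A" for x
    using Min_le[OF assms(1) that] assms(2) by linarith
  then show ?thesis
    using assms(1) by (metis Min_eqI finite_insert insertE insertI1 less_imp_le less_irrefl order_refl)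
qed

text \<open>\<open>marked_swap\<close> injects the pairs with a cut into such pairs, and
  \<open>move\<close> those without a cut into such pairs. As \<open>k > 0\<close>, all sets
  involved are nonempty and their minima meaningful.\<close>

lemma card_marked_hitting_log_concave:
  assumes "k > 0"
  shows "card (marked_hitting n k) * card (marked_hitting n (k + 2))
     \<le> card (marked_hitting n (k + 1)) * card (marked_hitting n (k + 1))"
proof -
  define cross where "cross = (\<lambda>((i :: nat, A), (j :: nat, B)). \<exists>t. crossing 1 A B t)"
  let ?X = "marked_hitting n k \<times> marked_hitting n (k + 2)"
  let ?Y = "marked_hitting n (k + 1) \<times> marked_hitting n (k + 1)"
  have D: "finite A" "hits A" "card A = m" "A \<subseteq> {..n}" "i < Min A" "A \<in> hitting {..n} m"
    if "(i, A) \<in> marked_hitting n m" for i A m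
    using that by (auto simp: mem_marked_hitting hitting_def intro: finite_subset)
  have swap: "marked_swap P \<in> {P \<in> ?Y. cross P} \<and> marked_swap (marked_swap P) = P"
    if "P \<in> {P \<in> ?X. cross P}" for P
  proof -
    obtain i A j B where P: "P = ((i, A), (j, B))" by (metis surj_pair)
    with that have A: "(i, A) \<in> marked_hitting n k" and B: "(j, B) \<in> marked_hitting n (k + 2)"
      and ex: "\<exists>t. crossing 1 A B t" by (auto simp: cross_def)
    define t where "t = first_crossing 1 (A, B)"
    have t: "crossing 1 A B t" unfolding t_def using crossing_first[OF ex] .
    have sw: "swap (Suc 0) (A, B) = (glue t A B, glue t B A)" by (simp add: swap_def t_def)
    have "A \<inter> {..<t} \<noteq> {}" "B \<inter> {..<t} \<noteq> {}" using t by (auto simp: crossing_def)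
    then have "Min (glue t A B) = Min A" "Min (glue t B A) = Min B"
      using Min_glue D[OF A] D[OF B] by auto
    moreover have "crossing 1 (glue t A B) (glue t B A) t"
      using crossing_glue D[OF A] D[OF B] t by simp
    moreover have "(glue t A B, glue t B A) \<in> hitting {..n} (k + 1) \<times> hitting {..n} (k + 1)"
      using swap_hitting[OF _ _ _ ex, of "{..n}" k] D[OF A] D[OF B] sw by simp
    ultimately have "marked_swap P \<in> {P \<in> ?Y. cross P}"
      using D[OF A] D[OF B]
      by (auto simp: P marked_swap_def sw cross_def mem_marked_hitting)
    moreover have "marked_swap (marked_swap P) = P"
      using swap_swap[OF _ _ _ _ ex] D[OF A] D[OF B]
      by (simp add: P marked_swap_def sw)
    ultimately show ?thesis by simp
  qed
  have move: "move P \<in> {P \<in> ?Y. \<not> cross P} \<and> unmove (move P) = P"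
    if "P \<in> {P \<in> ?X. \<not> cross P}" for P
  proof -
    obtain i A j B where P: "P = ((i, A), (j, B))" by (metis surj_pair)
    with that have A: "(i, A) \<in> marked_hitting n k" and B: "(j, B) \<in> marked_hitting n (k + 2)"
      and no: "\<nexists>t. crossing 1 A B t" by (auto simp: cross_def)
    note A = D[OF A] and B = D[OF B]
    define b where "b = Min B"
    define C where "C = B - {b}"
    have "A \<noteq> {}" "B \<noteq> {}" using A(3) B(3) \<open>k > 0\<close> by auto
    then have "b \<in> B" unfolding b_def using B(1) by simp
    then have cardC: "card C = k + 1" unfolding C_def using B by simp
    then have C: "C \<noteq> {}" by auto
    have "finite C" "C \<subseteq> {..n}" using B by (auto simp: C_def)
    note C = C this
    have x: "Min C < Min A" "b < Min C"
      using no_crossing_low[OF A(1) B(1) A(2) B(2) _ \<open>A \<noteq> {}\<close> no] A(3) B(3)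
      by (auto simp: C_def b_def)
    have hitsC: "hits C"
      using hits_remove_Min[OF A(1) B(1) A(2) B(2)] C x by (simp add: C_def b_def)
    \<comment> \<open>\<open>y\<close> is the element added to \<open>A\<close> and
      \<open>i'\<close> the new mark of \<open>C\<close>: these are \<open>b\<close> and
      \<open>i\<close>, in an order that respects the bounds on both marks.\<close>
    define y where "y = (if i < Min C then b else i)"
    define i' where "i' = (if i < Min C then i else b)"
    have y: "y < Min A" and i': "i' < Min C" and "j < y" and yC: "y < Min C \<longleftrightarrow> i < Min C"
      using x A(5) B(5) by (auto simp: y_def i'_def b_def)
    have eq: "move P = ((i', C), (j, insert y A))"
      by (simp add: P move_def Let_def y_def i'_def C_def b_def)
    have Y: "Min (insert y A) = y" "y \<notin> A" using Min_insert_less[OF A(1) y] by auto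
    have "Min A \<le> n" using A(1,4) \<open>A \<noteq> {}\<close> Min_in by blast
    then have "(j, insert y A) \<in> marked_hitting n (k + 1)"
      using A Y y \<open>j < y\<close> hits_mono[OF A(2), of "insert y A"]
      by (auto simp: mem_marked_hitting hitting_def)
    moreover have "(i', C) \<in> marked_hitting n (k + 1)"
      using C cardC hitsC i' by (auto simp: mem_marked_hitting hitting_def)
    moreover have "\<not> crossing 1 C (insert y A) t" for t
      using no_crossing_move[OF A(1) B(1) A(2) B(2) \<open>A \<noteq> {}\<close>, of y t] C x y no
      by (auto simp: C_def b_def)
    ultimately have "move P \<in> {P \<in> ?Y. \<not> cross P}"
      by (simp add: eq cross_def)
    moreover have "unmove (move P) = P"
    proof -
      have "insert b C = B" using \<open>b \<in> B\<close> by (auto simp: C_def)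
      moreover have "insert y A - {y} = A" using Y by auto
      ultimately show ?thesis
        using yC unfolding eq unmove_def by (simp add: P Let_def Y(1)) (simp add: y_def i'_def)
    qed
    ultimately show ?thesis by simp
  qed
  have fin: "finite ?X" "finite ?Y" by (simp_all add: finite_marked_hitting)
  have split: "card Z = card {P \<in> Z. cross P} + card {P \<in> Z. \<not> cross P}" if "finite Z" for Z
    using card_Un_disjoint[of "{P \<in> Z. cross P}" "{P \<in> Z. \<not> cross P}"] that
    by (simp add: Collect_disj_eq[symmetric] conj_disj_distribL[symmetric] disjoint_iff)
  have "card {P \<in> ?X. cross P} \<le> card {P \<in> ?Y. cross P}"
  proof (rule card_inj_on_le)
    show "inj_on marked_swap {P \<in> ?X. cross P}"
      by (rule inj_on_inverseI[of _ marked_swap]) (use swap in blast)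
    show "marked_swap ` {P \<in> ?X. cross P} \<subseteq> {P \<in> ?Y. cross P}"
      using swap by blast
  qed (use fin in simp)
  moreover have "card {P \<in> ?X. \<not> cross P} \<le> card {P \<in> ?Y. \<not> cross P}"
  proof (rule card_inj_on_le)
    show "inj_on move {P \<in> ?X. \<not> cross P}"
      by (rule inj_on_inverseI[of _ unmove]) (use move in blast)
    show "move ` {P \<in> ?X. \<not> cross P} \<subseteq> {P \<in> ?Y. \<not> cross P}"
      using move by blast
  qed (use fin in simp)
  ultimately have "card ?X \<le> card ?Y"
    using split[OF fin(1)] split[OF fin(2)] by linarith
  then show ?thesis by (simp add: card_cartesian_product)
qed

end

section \<open>Powers of paths and cycles\<close>

text \<open>The infimum of a nonempty set in \<open>enat\<close> is attained, and the empty set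
  would give infinity. A walk with at most \<open>l\<close> edges lists at most \<open>Suc l\<close>
  vertices.\<close>

lemma gdist_le_iff: "gdist G u v \<le> enat l \<longleftrightarrow> (\<exists>p. walk G u p v \<and> length p \<le> Suc l)"
proof
  let ?S = "(\<lambda>p. enat (length p - 1)) ` {p. walk G u p v}"
  assume le: "gdist G u v \<le> enat l"
  then have "?S \<noteq> {}"
    unfolding gdist_def by (metis Inf_empty enat_ord_code(5) top_enat_def)
  then have "Inf ?S \<in> ?S"
    unfolding Inf_enat_def by (auto intro: LeastI)
  then obtain p where "walk G u p v" "gdist G u v = enat (length p - 1)"
    unfolding gdist_def by auto
  then show "\<exists>p. walk G u p v \<and> length p \<le> Suc l"
    using le by (intro exI[of _ p]) auto
next
  assume "\<exists>p. walk G u p v \<and> length p \<le> Suc l"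
  then obtain p where p: "walk G u p v" "length p \<le> Suc l" by blast
  then have "gdist G u v \<le> enat (length p - 1)"
    unfolding gdist_def by (intro INF_lower) simp
  also have "\<dots> \<le> enat l" using p by simp
  finally show "gdist G u v \<le> enat l" .
qed

lemma verts_path_power [simp]: "verts (graph_power l (path_graph n)) = {..<n}"
  by (simp add: graph_power_def path_graph_def)

lemma verts_cycle_power [simp]: "verts (graph_power l (cycle_graph n)) = {..<n}"
  by (simp add: graph_power_def cycle_graph_def)

lemma walk_sym: "walk G u p v \<Longrightarrow> walk G v (rev p) u"
  unfolding walk_def successively_rev
  by (auto simp: hd_rev last_rev adjacent_def insert_commute)

lemma adjacent_graph_power:
  "adjacent (graph_power l G) u v \<longleftrightarrow>
     u \<in> verts G \<and> v \<in> verts G \<and> u \<noteq> v \<and> (\<exists>p. walk G u p v \<and> length p \<le> Suc l)"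
proof -
  have "(\<exists>p. walk G u p v \<and> length p \<le> Suc l) = (\<exists>p. walk G v p u \<and> length p \<le> Suc l)"
    by (metis walk_sym length_rev)
  then show ?thesis
    unfolding adjacent_def graph_power_def gdist_le_iff by (auto simp: doubleton_eq_iff)
qed

lemma successively_map_upt:
  "successively P (map f [0..<k]) \<longleftrightarrow> (\<forall>i. Suc i < k \<longrightarrow> P (f i) (f (Suc i)))"
  by (auto simp: successively_conv_nth)

lemma path_walk_iff:
  assumes "u < n" "v < n"
  shows "(\<exists>p. walk (path_graph n) u p v \<and> length p \<le> Suc l) \<longleftrightarrow> u \<le> v + l \<and> v \<le> u + l"
proof
  \<comment> \<open>Each edge changes the vertex by one, so a walk moves no farther than its number
    of edges.\<close>
  have "hd p \<le> last p + (length p - 1) \<and> last p \<le> hd p + (length p - 1)"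
    if "successively (adjacent (path_graph n)) p" "p \<noteq> []" for p
    using that
    by (induction p rule: induct_list012)
      (auto simp: adjacent_def path_graph_def doubleton_eq_iff)
  then show "u \<le> v + l \<and> v \<le> u + l"
    if "\<exists>p. walk (path_graph n) u p v \<and> length p \<le> Suc l"
    using that unfolding walk_def by fastforce
next
  have ex: "\<exists>p. walk (path_graph n) x p y \<and> length p \<le> Suc l" if "x \<le> y" "y \<le> x + l" "y < n" for x y
    using that
    by (intro exI[of _ "map (\<lambda>i. x + i) [0..<Suc (y - x)]"])
      (auto simp: walk_def successively_map_upt hd_map last_map adjacent_def path_graph_def
        simp del: upt_Suc)
  assume "u \<le> v + l \<and> v \<le> u + l"
  then show "\<exists>p. walk (path_graph n) u p v \<and> length p \<le> Suc l"
    using ex[of u v] ex[of v u] assms walk_sym[of "path_graph n" v _ u]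
    by (metis length_rev nle_le)
qed

lemma dominating_set_path_iff:
  "dominating_set (graph_power l (path_graph n)) D \<longleftrightarrow>
     D \<subseteq> {..<n} \<and> (\<forall>v<n. D \<inter> {v - l..v + l} \<noteq> {})"
proof -
  have "(v \<in> D \<or> (\<exists>u\<in>D. adjacent (graph_power l (path_graph n)) v u)) \<longleftrightarrow> D \<inter> {v - l..v + l} \<noteq> {}"
    if "D \<subseteq> {..<n}" "v < n" for v
  proof -
    have "(v = u \<or> adjacent (graph_power l (path_graph n)) v u) \<longleftrightarrow> u \<in> {v - l..v + l}" if "u \<in> D" for u
    proof -
      have "u < n" using that \<open>D \<subseteq> {..<n}\<close> by auto
      then show ?thesis
        using path_walk_iff[OF \<open>v < n\<close> \<open>u < n\<close>, of l] \<open>v < n\<close>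
        unfolding adjacent_graph_power by (auto simp: path_graph_def)
    qed
    then show ?thesis by blast
  qed
  then show ?thesis
    by (fastforce simp: dominating_set_def verts_path_power)
qed

text \<open>The signed displacement \<open>i\<close> adds up steps of 1 or -1 modulo
  \<open>n\<close>. Distinct \<open>u\<close> and \<open>v\<close> force \<open>n \<ge> 2\<close>,
  so that successive residues differ and form an edge.\<close>

lemma cycle_walk_iff:
  assumes "u < n" "v < n" "u \<noteq> v"
  shows "(\<exists>p. walk (cycle_graph n) u p v \<and> length p \<le> Suc l) \<longleftrightarrow>
    (\<exists>i. \<bar>i\<bar> \<le> int l \<and> [int v = int u + i] (mod int n))"
proof
  have adj: "\<exists>i. \<bar>i\<bar> \<le> 1 \<and> [int y = int x + i] (mod int n)" if "adjacent (cycle_graph n) x y" for x y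
  proof -
    have "y = Suc x mod n \<or> x = Suc y mod n"
      using that by (auto simp: adjacent_def cycle_graph_def doubleton_eq_iff)
    then show ?thesis
    proof
      assume "y = Suc x mod n"
      then show ?thesis by (intro exI[of _ 1]) (simp add: cong_def zmod_int add.commute)
    next
      assume "x = Suc y mod n"
      then have "[int x = int y + 1] (mod int n)" by (simp add: cong_def zmod_int add.commute)
      then have "[int y = int x + - 1] (mod int n)"
        using cong_diff[of "int x" "int y + 1" "int n" 1 1] by (simp add: cong_sym)
      then show ?thesis by (intro exI[of _ "-1"]) simp
    qed
  qed
  have "\<exists>i. \<bar>i\<bar> \<le> int (length p - 1) \<and> [int (last p) = int (hd p) + i] (mod int n)"
    if "successively (adjacent (cycle_graph n)) p" "p \<noteq> []" for p
    using that
  proof (induction p rule: induct_list012)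
    case (2 x)
    then show ?case by (intro exI[of _ 0]) simp
  next
    case (3 x y p)
    obtain i where i: "\<bar>i\<bar> \<le> int (length (y # p) - 1)"
        "[int (last (y # p)) = int (hd (y # p)) + i] (mod int n)"
      using 3 by auto
    obtain j where j: "\<bar>j\<bar> \<le> 1" "[int y = int x + j] (mod int n)"
      using adj 3 by auto
    have "[int y + i = int x + j + i] (mod int n)"
      using j(2) by (intro cong_add cong_refl)
    then have "[int (last (y # p)) = int x + (j + i)] (mod int n)"
      using cong_trans[OF i(2)] by (simp add: add.assoc)
    then show ?case using i(1) j(1) by (intro exI[of _ "j + i"]) auto
  qed simp
  moreover assume "\<exists>p. walk (cycle_graph n) u p v \<and> length p \<le> Suc l"
  then obtain p where "p \<noteq> []" "hd p = u" "last p = v" "successively (adjacent (cycle_graph n)) p"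
    "length p \<le> Suc l"
    unfolding walk_def by blast
  ultimately obtain i where "\<bar>i\<bar> \<le> int (length p - 1)" "[int v = int u + i] (mod int n)"
    by blast
  then show "\<exists>i. \<bar>i\<bar> \<le> int l \<and> [int v = int u + i] (mod int n)"
    using \<open>length p \<le> Suc l\<close> by (intro exI[of _ i]) auto
next
  have "n \<ge> 2" using assms by linarith
  have adj: "adjacent (cycle_graph n) (x mod n) (Suc x mod n)" for x
  proof -
    have "Suc (x mod n) mod n \<noteq> x mod n"
      using \<open>n \<ge> 2\<close> mod_less_divisor[of n x] by (auto simp: mod_Suc)
    then show ?thesis
      using \<open>n \<ge> 2\<close> unfolding adjacent_def cycle_graph_def
      by (auto intro!: exI[of _ "x mod n"] simp: mod_Suc_eq)
  qed
  have ex: "\<exists>p. walk (cycle_graph n) x p y \<and> length p \<le> Suc l"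
    if "x < n" "y = (x + j) mod n" "j \<le> l" for x y j
    using that adj \<open>n \<ge> 2\<close>
    by (intro exI[of _ "map (\<lambda>i. (x + i) mod n) [0..<Suc j]"])
      (auto simp: walk_def successively_map_upt hd_map last_map cycle_graph_def simp del: upt_Suc)
  assume "\<exists>i. \<bar>i\<bar> \<le> int l \<and> [int v = int u + i] (mod int n)"
  then obtain i where i: "\<bar>i\<bar> \<le> int l" "[int v = int u + i] (mod int n)" by blast
  show "\<exists>p. walk (cycle_graph n) u p v \<and> length p \<le> Suc l"
  proof (cases "i \<ge> 0")
    case True
    then have "int v = int ((u + nat i) mod n)"
      using i(2) assms by (simp add: cong_def zmod_int)
    then have "v = (u + nat i) mod n" by linarith
    then show ?thesis using ex[of u v "nat i"] i(1) assms by simp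
  next
    case False
    \<comment> \<open>A negative displacement becomes a forward walk from \<open>v\<close> to
      \<open>u\<close>, to be reversed.\<close>
    have "[int u = int v + - i] (mod int n)"
      using cong_diff[OF i(2) cong_refl[of i]] by (simp add: cong_sym)
    then have "int u = int ((v + nat (- i)) mod n)"
      using False assms by (simp add: cong_def zmod_int)
    then have "u = (v + nat (- i)) mod n" by linarith
    moreover have "nat (- i) \<le> l" using i(1) by linarith
    ultimately obtain p where "walk (cycle_graph n) v p u" "length p \<le> Suc l"
      using ex \<open>v < n\<close> by blast
    then show ?thesis using walk_sym by (metis length_rev)
  qed
qed

lemma dominating_set_cycle_iff:
  "dominating_set (graph_power l (cycle_graph n)) D \<longleftrightarrow>
     D \<subseteq> {..<n} \<and> (\<forall>v<n. \<exists>u\<in>D. \<exists>i. \<bar>i\<bar> \<le> int l \<and> [int u = int v + i] (mod int n))"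
proof -
  have "(v \<in> D \<or> (\<exists>u\<in>D. adjacent (graph_power l (cycle_graph n)) v u)) \<longleftrightarrow>
      (\<exists>u\<in>D. \<exists>i. \<bar>i\<bar> \<le> int l \<and> [int u = int v + i] (mod int n))"
    if "D \<subseteq> {..<n}" "v < n" for v
  proof -
    have "(v = u \<or> adjacent (graph_power l (cycle_graph n)) v u) \<longleftrightarrow>
        (\<exists>i. \<bar>i\<bar> \<le> int l \<and> [int u = int v + i] (mod int n))" if "u \<in> D" for u
    proof (cases "v = u")
      case True
      then show ?thesis by (auto intro!: exI[of _ 0])
    next
      case False
      have "u < n" using that \<open>D \<subseteq> {..<n}\<close> by auto
      then show ?thesis
        using cycle_walk_iff[OF \<open>v < n\<close> \<open>u < n\<close> False, of l] \<open>v < n\<close> False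
        unfolding adjacent_graph_power by (auto simp: cycle_graph_def)
    qed
    then show ?thesis by blast
  qed
  then show ?thesis
    by (fastforce simp: dominating_set_def verts_cycle_power)
qed

section \<open>Windows and rotations\<close>

definition path_windows :: "nat \<Rightarrow> nat \<Rightarrow> nat set set" where
  "path_windows l n = (\<lambda>v. {v - l..v + l}) ` {..<n}"

text \<open>Arcs of \<open>2 * l + 1\<close> positions, unrolled instead of reduced modulo
  \<open>n\<close>. An arc extending beyond \<open>n\<close> contains \<open>n\<close>, which the
  window \<open>{n}\<close> forces into every hitting set.\<close>

definition cycle_windows :: "nat \<Rightarrow> nat \<Rightarrow> nat set set" where
  "cycle_windows l n = insert {n} ((\<lambda>v. {Suc v..Suc (v + 2 * l)}) ` {..<n})"

interpretation path: interval_family "path_windows l n" for l n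
  by unfold_locales (auto simp: path_windows_def)

interpretation cycle: interval_family "cycle_windows l n" for l n
  by unfold_locales (auto simp: cycle_windows_def)

lemma cycle_hits_iff:
  "cycle.hits l n E \<longleftrightarrow> n \<in> E \<and> (\<forall>v<n. \<exists>e\<in>E. Suc v \<le> e \<and> e \<le> Suc (v + 2 * l))"
proof -
  have "E \<inter> {Suc v..Suc (v + 2 * l)} \<noteq> {} \<longleftrightarrow> (\<exists>e\<in>E. Suc v \<le> e \<and> e \<le> Suc (v + 2 * l))" for v
    by auto
  then show ?thesis
    unfolding cycle.hits_def by (auto simp: cycle_windows_def)
qed

lemma domination_seq_path:
  "domination_seq (graph_power l (path_graph n)) k = card (path.hitting l n {..<n} k)"
  unfolding domination_seq_def path.hitting_def path.hits_def dominating_set_path_iff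
  by (auto simp: path_windows_def intro: arg_cong[where f = card])

text \<open>Rotating a dominating set \<open>D\<close> of the cycle so that its largest element moves to \<open>n\<close> makes
  the windows that wrap around harmless, as they all contain \<open>n\<close>.\<close>

lemma dominating_shift_iff:
  assumes D: "D \<subseteq> {..<n}" and s: "s > 0" "d \<in> D" "d + s = n" "\<And>u. u \<in> D \<Longrightarrow> u \<le> d"
  shows "dominating_set (graph_power l (cycle_graph n)) D \<longleftrightarrow> cycle.hits l n ((\<lambda>u. u + s) ` D)"
proof
  have "n > 0" using s by simp
  assume "dominating_set (graph_power l (cycle_graph n)) D"
  then have dom: "\<exists>u\<in>D. \<exists>i. \<bar>i\<bar> \<le> int l \<and> [int u = int v + i] (mod int n)" if "v < n" for v
    using that by (simp add: dominating_set_cycle_iff)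
  have "\<exists>u\<in>D. Suc v \<le> u + s \<and> u + s \<le> Suc (v + 2 * l)" if v: "v < n" for v
  proof -
    \<comment> \<open>The vertex whose rotated position is, modulo \<open>n\<close>, the centre
      \<open>v + 1 + l\<close> of the window.\<close>
    define w where "w = nat ((int v + int l + 1 - int s) mod int n)"
    have w: "int w = (int v + int l + 1 - int s) mod int n"
      using \<open>n > 0\<close> by (simp add: w_def)
    then have "w < n"
      using \<open>n > 0\<close> by (metis of_nat_0_less_iff of_nat_less_iff pos_mod_bound)
    then obtain u i where u: "u \<in> D" "\<bar>i\<bar> \<le> int l" "[int u = int w + i] (mod int n)"
      using dom by blast
    have "[int w = int v + int l + 1 - int s] (mod int n)"
      unfolding w by (simp add: cong_def)
    then have "[int w + i + int s = (int v + int l + 1 - int s) + i + int s] (mod int n)"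
      by (intro cong_add cong_refl)
    moreover have "[int u + int s = int w + i + int s] (mod int n)"
      using u(3) by (intro cong_add cong_refl)
    ultimately have c: "[int u + int s = int v + 1 + (int l + i)] (mod int n)"
      by (metis (no_types, opaque_lifting) cong_trans add.commute add.left_commute diff_add_cancel add_diff_eq)
    show ?thesis
    \<comment> \<open>In the first case both sides of \<open>c\<close> lie between 1 and
      \<open>n\<close>, so congruence is equality. Otherwise the window reaches \<open>n\<close> and
      is hit by \<open>d + s\<close>.\<close>
    proof (cases "int v + 1 + (int l + i) \<le> int n")
      case True
      have "u + s \<le> n" using s(3) s(4)[OF u(1)] by simp
      have "[int u + int s - 1 = int v + (int l + i)] (mod int n)"
        using cong_diff[OF c cong_refl[of 1]] by simp
      then have "int u + int s - 1 = int v + (int l + i)"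
        using True \<open>u + s \<le> n\<close> s(1) u(2) by (intro cong_less_imp_eq_int) auto
      then show ?thesis using u(1,2) by (intro bexI[of _ u]) auto
    next
      case False
      then show ?thesis using s v u(2) by (intro bexI[of _ d]) auto
    qed
  qed
  then show "cycle.hits l n ((\<lambda>u. u + s) ` D)"
    using s unfolding cycle_hits_iff by (metis (no_types, lifting) image_eqI)
next
  have "n > 0" using s by simp
  assume hits: "cycle.hits l n ((\<lambda>u. u + s) ` D)"
  have hits: "\<exists>u\<in>D. Suc v \<le> u + s \<and> u + s \<le> Suc (v + 2 * l)" if "v < n" for v
    using hits that unfolding cycle_hits_iff by auto
  have "\<exists>u\<in>D. \<exists>i. \<bar>i\<bar> \<le> int l \<and> [int u = int v + i] (mod int n)" if "v < n" for v
  proof -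
    \<comment> \<open>Chosen so that the centre \<open>w + 1 + l\<close> of its window is, modulo
      \<open>n\<close>, the rotated position of \<open>v\<close>; \<open>j\<close> is the offset of
      \<open>u + s\<close> from this centre.\<close>
    define w where "w = nat ((int v + int s - 1 - int l) mod int n)"
    have w: "int w = (int v + int s - 1 - int l) mod int n"
      using \<open>n > 0\<close> by (simp add: w_def)
    then have "w < n"
      using \<open>n > 0\<close> by (metis of_nat_0_less_iff of_nat_less_iff pos_mod_bound)
    then obtain u where u: "u \<in> D" "Suc w \<le> u + s" "u + s \<le> Suc (w + 2 * l)"
      using hits by blast
    define j where "j = int u + int s - 1 - int w - int l"
    have "[int w = int v + int s - 1 - int l] (mod int n)"
      unfolding w by (simp add: cong_def)
    then have "[int w + (int l + 1 + j - int s) = (int v + int s - 1 - int l) + (int l + 1 + j - int s)] (mod int n)"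
      by (intro cong_add cong_refl)
    then have "[int u = int v + j] (mod int n)"
      by (simp add: j_def algebra_simps)
    moreover have "\<bar>j\<bar> \<le> int l" using u unfolding j_def by linarith
    ultimately show ?thesis using u(1) by blast
  qed
  then show "dominating_set (graph_power l (cycle_graph n)) D"
    using D by (simp add: dominating_set_cycle_iff)
qed

lemma not_dominating_empty: "verts G \<noteq> {} \<Longrightarrow> \<not> dominating_set G {}"
  by (auto simp: dominating_set_def)

text \<open>For \<open>i = n - 1 - Max D\<close>, the shift by \<open>Suc i\<close> moves the
  maximum to \<open>n\<close>. The bound \<open>i < Min E\<close> ensures that shifting back by
  \<open>Suc i\<close> never truncates a subtraction, so every mark belongs to a dominating
  set.\<close>

lemma domination_seq_cycle:
  assumes "n > 0"
  shows "domination_seq (graph_power l (cycle_graph n)) k = card (cycle.marked_hitting l n n k)"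
proof -
  let ?dom = "dominating_set (graph_power l (cycle_graph n))"
  define f where "f = (\<lambda>(i, E). (\<lambda>e. e - Suc i) ` E)"
  define g where "g D = (n - 1 - Max D, (\<lambda>d. d + Suc (n - 1 - Max D)) ` D)" for D
  have "bij_betw f (cycle.marked_hitting l n n k) {D. ?dom D \<and> card D = k}"
  proof (rule bij_betw_byWitness[where f' = g])
    have f: "g (f P) = P \<and> f P \<in> {D. ?dom D \<and> card D = k}"
      if "P \<in> cycle.marked_hitting l n n k" for P
    proof -
      obtain i E where P: "P = (i, E)" by (cases P)
      with that have E: "E \<subseteq> {..n}" "cycle.hits l n E" "card E = k" "i < Min E"
        by (auto simp: cycle.mem_marked_hitting cycle.hitting_def)
      have fin: "finite E" using E(1) finite_subset by blast
      have "n \<in> E" using E(2) by (simp add: cycle_hits_iff)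
      have low: "Suc i \<le> e" if "e \<in> E" for e
        using Min_le[OF fin that] E(4) by simp
      define D where "D = f P"
      have D: "D = (\<lambda>e. e - Suc i) ` E" by (simp add: D_def P f_def)
      have shift_back: "(\<lambda>d. d + Suc i) ` D = E"
        unfolding D image_image using low by (force simp: image_iff)
      have "D \<subseteq> {..<n}" using E(1) low unfolding D by fastforce
      moreover have "n - Suc i \<in> D" using \<open>n \<in> E\<close> unfolding D by blast
      moreover have max: "u \<le> n - Suc i" if "u \<in> D" for u
        using that E(1) unfolding D by (auto intro: diff_le_mono)
      ultimately have "?dom D"
        using dominating_shift_iff[of D n "Suc i" "n - Suc i" l] shift_back E(2) low[OF \<open>n \<in> E\<close>] by simp
      moreover have "card D = k"
        using E(3) card_image[of "\<lambda>d. d + Suc i" D] unfolding shift_back by (simp add: inj_on_def)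
      moreover have "Max D = n - Suc i"
        using max \<open>n - Suc i \<in> D\<close> fin unfolding D by (intro Max_eqI) auto
      then have "n - 1 - Max D = i" using low[OF \<open>n \<in> E\<close>] by simp
      then have "g D = P" using shift_back by (simp add: g_def P)
      ultimately show ?thesis by (simp add: D_def)
    qed
    have g: "f (g D) = D \<and> g D \<in> cycle.marked_hitting l n n k" if "D \<in> {D. ?dom D \<and> card D = k}" for D
    proof -
      have dom: "?dom D" "card D = k" using that by auto
      then have D: "D \<subseteq> {..<n}" by (simp add: dominating_set_cycle_iff)
      then have fin: "finite D" using finite_subset by blast
      have "D \<noteq> {}"
        using dom \<open>n > 0\<close> not_dominating_empty[of "graph_power l (cycle_graph n)"] by auto
      then have max: "Max D \<in> D" using fin by simp
      then have "Max D < n" using D by auto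
      define i where "i = n - 1 - Max D"
      have n: "Max D + Suc i = n" using \<open>Max D < n\<close> by (simp add: i_def)
      define E where "E = (\<lambda>d. d + Suc i) ` D"
      have "g D = (i, E)" by (simp add: g_def i_def E_def)
      have "f (i, E) = D" by (simp add: f_def E_def image_image)
      have "E \<subseteq> {..n}"
      proof
        fix e assume "e \<in> E"
        then obtain d where "d \<in> D" "e = d + Suc i" by (auto simp: E_def)
        then show "e \<in> {..n}" using Max_ge[OF fin, of d] n by simp
      qed
      moreover have "cycle.hits l n E"
        unfolding E_def using dominating_shift_iff[OF D _ max n] Max_ge[OF fin] dom by simp
      moreover have "card E = k"
        unfolding E_def using dom(2) by (simp add: card_image inj_on_def)
      moreover have "i < Min E"
        using fin \<open>D \<noteq> {}\<close> by (auto simp: E_def)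
      ultimately have "(i, E) \<in> cycle.marked_hitting l n n k"
        by (simp add: cycle.mem_marked_hitting cycle.hitting_def)
      then show ?thesis using \<open>g D = (i, E)\<close> \<open>f (i, E) = D\<close> by simp
    qed
    show "\<forall>P\<in>cycle.marked_hitting l n n k. g (f P) = P" using f by blast
    show "\<forall>D\<in>{D. ?dom D \<and> card D = k}. f (g D) = D" using g by blast
    show "f ` cycle.marked_hitting l n n k \<subseteq> {D. ?dom D \<and> card D = k}" using f by blast
    show "g ` {D. ?dom D \<and> card D = k} \<subseteq> cycle.marked_hitting l n n k" using g by blast
  qed
  then show ?thesis
    unfolding domination_seq_def by (simp add: bij_betw_same_card)
qed

section \<open>Unimodality of the domination sequences\<close>

lemma domination_seq_pos_iff:
  assumes "finite (verts G)"
  shows "domination_seq G k > 0 \<longleftrightarrow> (\<exists>D. dominating_set G D \<and> card D = k)"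
proof -
  have "finite {D. dominating_set G D \<and> card D = k}"
    by (rule finite_subset[of _ "Pow (verts G)"]) (use assms in \<open>auto simp: dominating_set_def\<close>)
  then show ?thesis
    unfolding domination_seq_def by (auto simp: card_gt_0_iff)
qed

text \<open>Supersets of dominating sets dominate, so positive terms continue up to the number of
  vertices, without internal zeros.\<close>

lemma unimodal_domination_seq:
  assumes fin: "finite (verts G)"
    and log_concave: "\<And>k. domination_seq G k * domination_seq G (k + 2)
      \<le> domination_seq G (k + 1) * domination_seq G (k + 1)"
  shows "unimodal (domination_seq G)"
proof (rule unimodal_if_log_concave[OF log_concave])
  show "domination_seq G j > 0" if pos: "domination_seq G i > 0" and "i \<le> j" "j \<le> card (verts G)" for i j
  proof -
    obtain D where D: "dominating_set G D" "card D = i"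
      using pos by (auto simp: domination_seq_pos_iff[OF fin])
    then have "D \<subseteq> verts G" by (simp add: dominating_set_def)
    with D obtain E where "D \<subseteq> E" "E \<subseteq> verts G" "card E = j"
      using exists_subset_between[of D j "verts G"] \<open>i \<le> j\<close> \<open>j \<le> card (verts G)\<close> fin by blast
    moreover have "dominating_set G E"
      using D \<open>D \<subseteq> E\<close> \<open>E \<subseteq> verts G\<close> unfolding dominating_set_def by blast
    ultimately show ?thesis by (auto simp: domination_seq_pos_iff[OF fin])
  qed
  show "domination_seq G k = 0" if "k > card (verts G)" for k
  proof (rule ccontr)
    assume "domination_seq G k \<noteq> 0"
    then obtain D where "D \<subseteq> verts G" "card D = k"
      using domination_seq_pos_iff[OF fin, of k] by (auto simp: dominating_set_def)
    then show False using card_mono[OF fin, of D] that by simp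
  qed
qed

lemma unimodal_path: "unimodal (domination_seq (graph_power l (path_graph n)))"
proof (rule unimodal_domination_seq)
  show "domination_seq (graph_power l (path_graph n)) k * domination_seq (graph_power l (path_graph n)) (k + 2)
      \<le> domination_seq (graph_power l (path_graph n)) (k + 1) * domination_seq (graph_power l (path_graph n)) (k + 1)" for k
    unfolding domination_seq_path by (intro path.card_hitting_log_concave) simp
qed simp

lemma unimodal_cycle:
  assumes "n > 0"
  shows "unimodal (domination_seq (graph_power l (cycle_graph n)))"
proof (rule unimodal_domination_seq)
  let ?G = "graph_power l (cycle_graph n)"
  show fin: "finite (verts ?G)" by simp
  fix k
  show "domination_seq ?G k * domination_seq ?G (k + 2) \<le> domination_seq ?G (k + 1) * domination_seq ?G (k + 1)"
  \<comment> \<open>The count of marked sets concerns nonempty sets. For \<open>k = 0\<close> the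
    left side vanishes, as the empty set dominates no nonempty graph.\<close>
  proof (cases "k = 0")
    case True
    have "\<not> (dominating_set ?G D \<and> card D = 0)" for D
      using not_dominating_empty[of ?G] \<open>n > 0\<close> finite_subset[OF _ fin, of D]
      by (auto simp: dominating_set_def)
    then have "domination_seq ?G 0 = 0"
      using domination_seq_pos_iff[OF fin, of 0] by blast
    then show ?thesis using True by simp
  next
    case False
    then show ?thesis
      unfolding domination_seq_cycle[OF assms] by (intro cycle.card_marked_hitting_log_concave) simp
  qed
qed

theorem theorem3:
  fixes n l :: nat
  assumes "l \<ge> 1"
  shows "unimodal (domination_seq (graph_power l (path_graph n))) \<and>
         unimodal (domination_seq (graph_power l (cycle_graph n)))"
proof (cases "n = 0")
  case True
  then have "cycle_graph n = path_graph n" by (simp add: cycle_graph_def path_graph_def)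
  then show ?thesis using unimodal_path by simp
next
  case False
  then show ?thesis using unimodal_path unimodal_cycle by simp
qed

end
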